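(* Let $\mathcal{K}$ be an arbitrary field and let $n,m$ be positive integers. Then any $m+1$ matrices $M_1,\ldots,M_{m+1}\in\mathcal{M}_{n\times m}$ are $\mathrm{GL}(n)$-dependent; that is, there exist $g_1,\ldots,g_{m+1}\in \mathrm{GL}(n,\mathcal{K})\cup\{0\}$, not all zero, such that $\sum_{i=1}^{m+1} g_iM_i=0$.
   Context: For a field $\mathcal{K}$ and positive integers $n,m$, $\mathcal{M}_{n\times m}$ denotes the set of $n\times m$ matrices over $\mathcal{K}$, and $\mathrm{GL}(n)=\mathrm{GL}(n,\mathcal{K})$ is the group of invertible $n\times n$ matrices over $\mathcal{K}$; in $\mathrm{GL}(n)\cup\{0\}$ the symbol $0$ is the zero $n\times n$ matrix. Definition: matrices $M_1,\ldots,M_k\in\mathcal{M}_{n\times m}$ are called $\mathrm{GL}(n)$-dependent if there exist $g_1,\ldots,g_k\in\mathrm{GL}(n)\cup\{0\}$, not all zero, such that $\sum_{i=1}^{k} g_iM_i=0$. *)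

theory Defs
  imports "Jordan_Normal_Form.Matrix"
begin

definition GL :: "nat \<Rightarrow> 'a :: field mat set" where
  "GL n = {A \<in> carrier_mat n n. invertible_mat A}"

(* The family M is indexed by {1..k}; it is meant to consist of elements of carrier_mat n m.
   The sum is taken in the additive group of n x m matrices, as the type 'a mat, which
   contains matrices of all sizes, has no global zero. *)
definition GL_dependent :: "nat \<Rightarrow> nat \<Rightarrow> nat \<Rightarrow> (nat \<Rightarrow> 'a :: field mat) \<Rightarrow> bool" where
  "GL_dependent n m k M \<longleftrightarrow>
     (\<exists>g. (\<forall>i\<in>{1..k}. g i \<in> GL n \<union> {0\<^sub>m n n}) \<and>
          (\<exists>i\<in>{1..k}. g i \<noteq> 0\<^sub>m n n) \<and>
          finsum (module_mat TYPE('a) n m) (\<lambda>i. g i * M i) {1..k} = 0\<^sub>m n m)"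

end

theory Submission
  imports
    Defs
    "HOL-Algebra.Algebraic_Closure_Type"
    "Jordan_Normal_Form.Char_Poly"
begin

text \<open>
  Let \<open>f\<close> be a polynomial of degree \<open>n\<close> over \<open>K\<close> and identify \<open>K\<^sup>n\<close> with \<open>K[X]/(f)\<close>, so that every
  polynomial \<open>p\<close> acts on columns by an \<open>n \<times> n\<close> matrix, namely multiplication by \<open>p\<close> modulo \<open>f\<close>. Reading the
  columns of the \<open>M\<^sub>i\<close> as polynomials of degree less than \<open>n\<close> gives \<open>m + 1\<close> vectors in \<open>K[X]\<^sup>m\<close>,
  hence a nontrivial relation \<open>\<Sum>\<^sub>i p\<^sub>i M\<^sub>i = 0\<close> over \<open>K[X]\<close>. It remains to choose \<open>f\<close> such that each
  \<open>p\<^sub>i\<close> is either divisible by \<open>f\<close> (and acts as \<open>0\<close>) or a non-zero-divisor modulo \<open>f\<close> (and acts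
  invertibly), the latter for at least one \<open>i\<close>. If \<open>K\<close> is infinite, \<open>f = (X - c)\<^sup>n\<close> works for any \<open>c\<close> that is
  not a root of a nonzero \<open>p\<^sub>i\<close>. If \<open>K\<close> is finite, take \<open>f\<close> irreducible, after dividing the \<open>p\<^sub>i\<close> by
  common powers of \<open>f\<close>.
\<close>

section \<open>Irreducible polynomials over finite fields\<close>

text \<open>Multiplication by a nonzero \<open>x\<close> permutes the nonzero elements; comparing
  their products gives \<open>x ^ (q - 1) = 1\<close>, where \<open>q\<close> is the order of the
  field.\<close>

lemma finite_field_power_card:
  fixes x :: "'a::field"
  assumes fin: "finite (UNIV :: 'a set)"
  shows "x ^ card (UNIV :: 'a set) = x"
proof (cases "x = 0")
  case True
  then show ?thesis
    using finite_UNIV_card_ge_0[OF fin] by (simp only: zero_power)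
next
  case False
  let ?U = "UNIV - {0 :: 'a}"
  have "(\<Prod>y\<in>?U. x * y) = \<Prod>?U"
    by (rule prod.reindex_bij_witness[of _ "\<lambda>y. y / x" "\<lambda>y. x * y"]) (use False in auto)
  then have "x ^ card ?U * \<Prod>?U = \<Prod>?U"
    by (simp add: prod.distrib)
  moreover have "\<Prod>?U \<noteq> 0"
    using fin by (simp add: prod_zero_iff)
  ultimately have "x ^ card ?U = 1"
    by (metis mult_cancel_right1)
  moreover have "card (UNIV :: 'a set) = Suc (card ?U)"
    using card_Suc_Diff1[OF fin UNIV_I, of 0] by (rule sym)
  ultimately show ?thesis
    by (simp only: power_Suc mult_1_right)
qed

lemma card_field_ge_2:
  assumes "finite (UNIV :: 'a::field set)"
  shows "2 \<le> card (UNIV :: 'a set)"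
  using card_mono[OF assms, of "{0, 1}"] by simp

text \<open>
  With \<open>q\<close> the order of the field, \<open>(X + 1)\<^sup>q - X\<^sup>q - 1\<close> has degree less than \<open>q\<close> and vanishes at all
  \<open>q\<close> field elements. This makes \<open>x \<mapsto> x\<^sup>q\<close> additive on the algebraic closure without
  knowing that \<open>q\<close> is a power of the characteristic.
\<close>

lemma of_nat_card_choose_eq_0:
  assumes fin: "finite (UNIV :: 'a::field set)"
    and i: "0 < i" "i < card (UNIV :: 'a set)"
  shows "of_nat (card (UNIV :: 'a set) choose i) = (0 :: 'a)"
proof -
  define q where "q = card (UNIV :: 'a set)"
  define p where "p = (\<Sum>i\<in>{1..<q}. monom (of_nat (q choose i) :: 'a) i)"
  have q: "2 \<le> q"
    unfolding q_def using fin by (rule card_field_ge_2)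
  have root: "poly p x = 0" for x
  proof -
    have "x + 1 = (x + 1) ^ q"
      unfolding q_def by (simp add: finite_field_power_card[OF fin])
    also have "\<dots> = (\<Sum>i\<le>q. of_nat (q choose i) * x ^ i)"
      by (simp add: binomial_ring)
    also have "{..q} = insert 0 (insert q {1..<q})"
      using q by auto
    also have "(\<Sum>i\<in>\<dots>. of_nat (q choose i) * x ^ i) = 1 + (x ^ q + poly p x)"
      using q by (simp add: p_def poly_sum poly_monom)
    also have "x ^ q = x"
      unfolding q_def by (rule finite_field_power_card[OF fin])
    finally show ?thesis
      by simp
  qed
  have "degree p < q"
    unfolding p_def using q
    by (intro le_less_trans[OF degree_sum_le[where n = "q - 1"]])
      (auto intro: le_trans[OF degree_monom_le])
  moreover have "q \<le> degree p" if "p \<noteq> 0"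
    using card_poly_roots_bound[OF that] root by (simp add: q_def)
  ultimately have "p = 0"
    by linarith
  then have "coeff p i = 0"
    by simp
  then show ?thesis
    using i by (simp add: p_def coeff_sum q_def)
qed

section \<open>The \<open>q\<close>-power Frobenius map on the algebraic closure\<close>

context
  fixes q :: nat
  assumes fin: "finite (UNIV :: 'a::field set)"
  defines "q \<equiv> card (UNIV :: 'a set)"
begin

lemma q_ge_2: "2 \<le> q"
  unfolding q_def using fin by (rule card_field_ge_2)

lemma frobenius_add: "(x + y) ^ q = x ^ q + y ^ q" for x y :: "'a alg_closure"
proof -
  have "of_nat (q choose i) * x ^ i * y ^ (q - i) = 0" if "i \<in> {1..<q}" for i
  proof -
    have "(of_nat (q choose i) :: 'a) = 0"
      unfolding q_def using that by (intro of_nat_card_choose_eq_0 fin) (auto simp: q_def)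
    then have "of_nat (q choose i) = (0 :: 'a alg_closure)"
      by (metis to_ac_0 to_ac_of_nat)
    then show ?thesis
      by simp
  qed
  then have mid: "(\<Sum>i\<in>{1..<q}. of_nat (q choose i) * x ^ i * y ^ (q - i)) = 0"
    by (intro sum.neutral) blast
  have "(x + y) ^ q = (\<Sum>i\<le>q. of_nat (q choose i) * x ^ i * y ^ (q - i))"
    by (rule binomial_ring)
  also have "{..q} = insert 0 (insert q {1..<q})"
    using q_ge_2 by auto
  also have "(\<Sum>i\<in>\<dots>. of_nat (q choose i) * x ^ i * y ^ (q - i)) = x ^ q + y ^ q"
    using q_ge_2 mid by simp
  finally show ?thesis .
qed

lemma power_q_Suc: "x ^ q ^ Suc d = (x ^ q ^ d) ^ q" for x :: "'b::monoid_mult"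
  by (simp only: power_Suc2 power_mult)

lemma frobenius_power_add: "(x + y) ^ q ^ d = x ^ q ^ d + y ^ q ^ d"
  for x y :: "'a alg_closure"
  by (induction d) (simp_all add: power_q_Suc frobenius_add del: power_Suc)

lemma frobenius_power_sum: "(\<Sum>i\<in>A. f i) ^ q ^ d = (\<Sum>i\<in>A. f i ^ q ^ d)"
  for f :: "'b \<Rightarrow> 'a alg_closure"
  using q_ge_2
  by (induction A rule: infinite_finite_induct) (simp_all add: frobenius_power_add zero_power)

text \<open>By additivity the difference \<open>x - y\<close> has a vanishing power, and a field has
  no nilpotents.\<close>

lemma frobenius_power_inj:
  fixes x y :: "'a alg_closure"
  assumes "x ^ q ^ d = y ^ q ^ d"
  shows "x = y"
proof -
  have "(x - y) ^ q ^ d + y ^ q ^ d = x ^ q ^ d"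
    by (simp flip: frobenius_power_add)
  then show ?thesis
    using assms by simp
qed

lemma to_ac_frobenius_power: "to_ac (c :: 'a) ^ q ^ d = to_ac c"
proof (induction d)
  case (Suc d)
  have "to_ac c ^ q ^ Suc d = (to_ac c ^ q ^ d) ^ q"
    by (rule power_q_Suc)
  also have "\<dots> = to_ac (c ^ q)"
    by (simp add: Suc)
  finally show ?case
    using finite_field_power_card[OF fin] by (simp add: q_def)
qed simp

text \<open>Frobenius fixes the coefficients, so it maps roots of a polynomial over the base field
  to roots.\<close>

lemma poly_frobenius_power:
  fixes p :: "'a poly"
  shows "poly (map_poly to_ac p) x ^ q ^ d = poly (map_poly to_ac p) (x ^ q ^ d)"
proof -
  have "(to_ac (coeff p i) * x ^ i) ^ q ^ d = to_ac (coeff p i) * (x ^ q ^ d) ^ i" for i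
    by (simp add: power_mult_distrib to_ac_frobenius_power mult.commute[of i] flip: power_mult)
  then show ?thesis
    by (simp add: poly_altdef degree_map_poly coeff_map_poly frobenius_power_sum)
qed

text \<open>The fixed points are the roots of \<open>p\<close>, i.e. X^(q^d) - X, which splits and,
  having derivative -1, has no repeated root.\<close>

lemma frobenius_power_fixed:
  assumes d: "0 < d"
  shows "finite {x :: 'a alg_closure. x ^ q ^ d = x}"
    and "card {x :: 'a alg_closure. x ^ q ^ d = x} = q ^ d"
proof -
  let ?Q = "q ^ d"
  define p :: "'a alg_closure poly" where "p = monom 1 ?Q - monom 1 1"
  have Q: "2 \<le> ?Q"
    using self_le_power[OF le_trans[OF one_le_numeral q_ge_2] d] q_ge_2 by (rule le_trans[rotated])
  have poly_p: "poly p x = x ^ ?Q - x" for x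
    by (simp add: p_def poly_monom)
  have deg: "degree p = ?Q"
    unfolding p_def diff_conv_add_uminus using Q
    by (subst degree_add_eq_left) (auto simp: degree_monom_eq)
  then have "p \<noteq> 0"
    using Q degree_0 by (metis not_numeral_le_zero)
  then obtain A where A: "size A = ?Q" "p = smult (lead_coeff p) (\<Prod>x\<in>#A. [:-x, 1:])"
    using alg_closed_imp_factorization[of p] deg by auto
  have "of_nat ?Q = (0 :: 'a)"
  proof -
    \<comment> \<open>As \<open>q choose 1 = q\<close>, the vanishing of the binomial coefficients
      shows that \<open>q\<close> is zero in the field.\<close>
    have "of_nat (q choose 1) = (0 :: 'a)"
      unfolding q_def using q_ge_2 by (intro of_nat_card_choose_eq_0 fin) (auto simp: q_def)
    then show ?thesis
      using d by simp
  qed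
  then have Q0: "of_nat ?Q = (0 :: 'a alg_closure)"
    by (metis to_ac_0 to_ac_of_nat)
  have pd: "pderiv p = [:-1:]"
    unfolding p_def pderiv_diff pderiv_monom using Q0 d by (simp add: monom_0 zero_power)
  have "count A x \<le> 1" for x
  proof (rule ccontr)
    assume "\<not> count A x \<le> 1"
    then have "{#x, x#} \<subseteq># A"
      by (simp add: subseteq_mset_def)
    then obtain B where "A = {#x, x#} + B"
      by (metis subset_mset.add_diff_inverse)
    then obtain r where r: "p = [:-x, 1:] * ([:-x, 1:] * r)"
      using A(2) by (metis (no_types, lifting) image_mset_add_mset image_mset_union
          prod_mset.add_mset mult_smult_right add_mset_add_single union_mset_add_mset_left
          empty_neutral(1))
    have "poly (pderiv p) x = 0"
      unfolding r pderiv_mult by simp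
    then show False
      by (simp add: pd)
  qed
  then have "size A = card (set_mset A)"
    by (simp add: size_multiset_overloaded_eq) (metis (no_types, lifting) One_nat_def Suc_leI count_greater_zero_iff le_antisym card_eq_sum sum.cong)
  moreover have "set_mset A = {x. x ^ ?Q = x}"
  proof -
    have "poly p x = 0 \<longleftrightarrow> x \<in># A" for x
      by (subst A(2)) (use \<open>p \<noteq> 0\<close> in \<open>auto simp: poly_prod_mset prod_mset_zero_iff\<close>)
    then show ?thesis
      by (auto simp: poly_p)
  qed
  ultimately show "card {x :: 'a alg_closure. x ^ ?Q = x} = ?Q"
      "finite {x :: 'a alg_closure. x ^ ?Q = x}"
    using A(1) by (metis, metis finite_set_mset)
qed

section \<open>Elements of degree \<open>n\<close> over the finite field\<close>

lemma sum_power_q_less: "(\<Sum>d<n. q ^ d) < q ^ n"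
proof (induction n)
  case (Suc n)
  have "(\<Sum>d<Suc n. q ^ d) < 2 * q ^ n"
    using Suc by simp
  also have "\<dots> \<le> q ^ Suc n"
    using q_ge_2 by simp
  finally show ?case .
qed simp

text \<open>Counting: the points fixed for some exponent \<open>0 < d < n\<close> are too few to
  exhaust the \<open>q ^ n\<close> points fixed for \<open>n\<close>.\<close>

lemma exists_frobenius_orbit:
  assumes n: "0 < n"
  obtains x :: "'a alg_closure"
  where "x ^ q ^ n = x" and "inj_on (\<lambda>i. x ^ q ^ i) {..<n}"
proof -
  let ?R = "\<lambda>d. {x :: 'a alg_closure. x ^ q ^ d = x}"
  have "card (\<Union>d\<in>{1..<n}. ?R d) \<le> (\<Sum>d\<in>{1..<n}. card (?R d))"
    by (rule card_UN_le) simp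
  also have "\<dots> = (\<Sum>d\<in>{1..<n}. q ^ d)"
    by (intro sum.cong) (auto simp: frobenius_power_fixed)
  also have "\<dots> \<le> (\<Sum>d<n. q ^ d)"
    by (intro sum_mono2) auto
  also have "\<dots> < card (?R n)"
    using sum_power_q_less frobenius_power_fixed(2)[OF n] by simp
  finally have less: "card (\<Union>d\<in>{1..<n}. ?R d) < card (?R n)" .
  have "finite (\<Union>d\<in>{1..<n}. ?R d)"
    by (auto simp: frobenius_power_fixed(1))
  then have "\<not> ?R n \<subseteq> (\<Union>d\<in>{1..<n}. ?R d)"
    using less card_mono leD by blast
  then obtain x :: "'a alg_closure"
    where x: "x ^ q ^ n = x" and notin: "x \<notin> (\<Union>d\<in>{1..<n}. ?R d)"
    by blast
  have not_fixed: "x ^ q ^ d \<noteq> x" if "0 < d" "d < n" for d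
  proof -
    have "d \<in> {1..<n}"
      using that by simp
    then show ?thesis
      using notin by blast
  qed
  \<comment> \<open>A coincidence of two conjugates cancels, by injectivity, to \<open>x\<close>
    being fixed for the exponent \<open>j - i\<close>.\<close>
  have neq: "x ^ q ^ i \<noteq> x ^ q ^ j" if "i < j" "j < n" for i j
  proof
    assume "x ^ q ^ i = x ^ q ^ j"
    also have "\<dots> = (x ^ q ^ (j - i)) ^ q ^ i"
      using that by (simp only: le_add_diff_inverse2 less_imp_le flip: power_mult power_add)
    finally have "x ^ q ^ (j - i) = x"
      by (rule frobenius_power_inj[symmetric])
    moreover have "0 < j - i" "j - i < n"
      using that by auto
    ultimately show False
      using not_fixed by blast
  qed
  have "inj_on (\<lambda>i. x ^ q ^ i) {..<n}"
    by (intro linorder_inj_onI) (simp_all only: neq lessThan_iff linear not_False_eq_True)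
  then show ?thesis
    using x that by blast
qed

text \<open>All \<open>n\<close> distinct conjugates of \<open>x\<close> are roots of
  \<open>p\<close>.\<close>

lemma degree_annihilator_ge:
  fixes x :: "'a alg_closure"
  assumes inj: "inj_on (\<lambda>i. x ^ q ^ i) {..<n}"
    and p: "p \<noteq> 0" "poly (map_poly to_ac p) x = 0"
  shows "n \<le> degree p"
proof -
  let ?p = "map_poly to_ac p"
  have p0: "?p \<noteq> 0"
    using p(1) by (auto simp: poly_eq_iff coeff_map_poly)
  have "poly ?p (x ^ q ^ i) = 0" for i
    using q_ge_2 by (simp add: p(2) zero_power flip: poly_frobenius_power)
  then have "card ((\<lambda>i. x ^ q ^ i) ` {..<n}) \<le> card {x. poly ?p x = 0}"
    by (intro card_mono poly_roots_finite p0) auto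
  also have "\<dots> \<le> degree ?p"
    by (rule card_poly_roots_bound[OF p0])
  finally show ?thesis
    using inj by (simp add: card_image degree_map_poly)
qed

text \<open>
  Pigeonhole: the \<open>q ^ (n + 1)\<close> polynomials of degree at most \<open>n\<close> take values at \<open>x\<close> among the
  \<open>q ^ n\<close> elements fixed by \<open>y \<mapsto> y ^ q ^ n\<close>.
\<close>

lemma exists_annihilator:
  fixes x :: "'a alg_closure"
  assumes n: "0 < n" and x: "x ^ q ^ n = x"
  obtains p where "p \<noteq> 0" and "degree p \<le> n" and "poly (map_poly to_ac p) x = 0"
proof -
  interpret map_poly_idom_hom "to_ac :: 'a \<Rightarrow> 'a alg_closure"
    by unfold_locales simp_all
  let ?C = "{..n} \<rightarrow>\<^sub>E (UNIV :: 'a set)"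
  let ?F = "\<lambda>c. \<Sum>i\<le>n. to_ac (c i) * x ^ i"
  have "?F c ^ q ^ n = ?F c" for c :: "nat \<Rightarrow> 'a"
  proof -
    have "(x ^ i) ^ q ^ n = (x ^ q ^ n) ^ i" for i
      by (simp only: mult.commute flip: power_mult)
    then have "(x ^ i) ^ q ^ n = x ^ i" for i
      by (simp only: x)
    then show ?thesis
      by (simp add: frobenius_power_sum power_mult_distrib to_ac_frobenius_power)
  qed
  then have "?F ` ?C \<subseteq> {x. x ^ q ^ n = x}"
    by blast
  then have "card (?F ` ?C) \<le> card {x :: 'a alg_closure. x ^ q ^ n = x}"
    by (rule card_mono[OF frobenius_power_fixed(1)[OF n]])
  also have "\<dots> = q ^ n"
    by (rule frobenius_power_fixed(2)[OF n])
  also have "\<dots> < card ?C"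
    using q_ge_2 by (simp add: card_PiE q_def)
  finally have "\<not> inj_on ?F ?C"
    by (rule pigeonhole)
  then obtain c c' where c: "c \<in> ?C" "c' \<in> ?C" "?F c = ?F c'" "c \<noteq> c'"
    unfolding inj_on_def by blast
  obtain j where j: "j \<le> n" "c j \<noteq> c' j"
    using PiE_ext[OF c(1,2)] c(4) by blast
  define p where "p = (\<Sum>i\<le>n. monom (c i - c' i) i)"
  have "coeff p j = c j - c' j"
    using j(1) by (simp add: p_def coeff_sum)
  then have "p \<noteq> 0"
    using j(2) by auto
  moreover have "degree p \<le> n"
    unfolding p_def by (intro degree_sum_le) (auto intro: le_trans[OF degree_monom_le])
  moreover have "poly (map_poly to_ac p) x = ?F c - ?F c'"
    by (simp add: p_def hom_sum poly_sum poly_monom left_diff_distrib sum_subtractf)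
  ultimately show ?thesis
    using c(3) that by simp
qed

end

text \<open>Here \<open>f\<close> is, up to a scalar, the minimal polynomial of \<open>x\<close>:
  its multiples are exactly the polynomials vanishing at \<open>x\<close>, so it is prime because
  the closure has no zero divisors.\<close>

lemma exists_prime_elem_poly_degree:
  assumes fin: "finite (UNIV :: 'a::field set)" and n: "0 < n"
  obtains f :: "'a::field poly" where "degree f = n" and "prime_elem f"
proof -
  interpret map_poly_idom_hom "to_ac :: 'a \<Rightarrow> 'a alg_closure"
    by unfold_locales simp_all
  obtain x :: "'a alg_closure"
    where x: "x ^ card (UNIV :: 'a set) ^ n = x"
      and inj: "inj_on (\<lambda>i. x ^ card (UNIV :: 'a set) ^ i) {..<n}"
    using exists_frobenius_orbit[OF fin n] by blast
  obtain f where f: "f \<noteq> 0" "degree f \<le> n" "poly (map_poly to_ac f) x = 0"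
    using exists_annihilator[OF fin n x] by blast
  have deg: "degree f = n"
    using degree_annihilator_ge[OF fin inj f(1,3)] f(2) by simp
  have dvd_iff: "f dvd p \<longleftrightarrow> poly (map_poly to_ac p) x = 0" for p
  proof
    assume "f dvd p"
    then show "poly (map_poly to_ac p) x = 0"
      using f(3) by (auto simp: hom_mult)
  next
    assume p: "poly (map_poly to_ac p) x = 0"
    have "p mod f = p - p div f * f"
      by (rule minus_div_mult_eq_mod[symmetric])
    then have "poly (map_poly to_ac (p mod f)) x = 0"
      using p f(3) by (simp only: hom_minus hom_mult poly_diff poly_mult) simp
    then have "p mod f = 0"
      using degree_annihilator_ge[OF fin inj, of "p mod f"] degree_mod_less[OF f(1), of p] deg
      by force
    then show "f dvd p"
      by (rule mod_0_imp_dvd)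
  qed
  have "prime_elem f"
  proof (rule prime_elemI)
    show "\<not> f dvd 1"
      using deg n by simp
    show "f dvd a \<or> f dvd b" if "f dvd a * b" for a b
      using that by (simp add: dvd_iff hom_mult)
  qed (rule f(1))
  then show ?thesis
    using deg that by blast
qed

section \<open>Linear dependence over the polynomial ring\<close>

text \<open>Fraction-free Gaussian elimination, removing one coordinate \<open>k\<close> and one
  pivot vector \<open>j\<close> at a time.\<close>

lemma idom_linear_dependence:
  fixes v :: "'i \<Rightarrow> 'k \<Rightarrow> 'a::idom"
  assumes "finite K" and "finite I" and "card K < card I"
  shows "\<exists>c. (\<exists>i\<in>I. c i \<noteq> 0) \<and> (\<forall>k\<in>K. (\<Sum>i\<in>I. c i * v i k) = 0)"
  using assms
proof (induction K arbitrary: I v rule: finite_induct)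
  case empty
  then have "I \<noteq> {}"
    by auto
  then show ?case
    by (intro exI[of _ "\<lambda>_. 1"]) auto
next
  case (insert k K)
  show ?case
  proof (cases "\<forall>i\<in>I. v i k = 0")
    case True
    have "card K < card I"
      using insert.prems insert.hyps by simp
    then obtain c where "\<exists>i\<in>I. c i \<noteq> 0" and "\<forall>l\<in>K. (\<Sum>i\<in>I. c i * v i l) = 0"
      using insert.IH[OF insert.prems(1)] by blast
    then show ?thesis
      using True by (intro exI[of _ c]) auto
  next
    case False
    then obtain j where j: "j \<in> I" "v j k \<noteq> 0"
      by blast
    let ?I = "I - {j}"
    have fin: "finite ?I" and card: "card K < card ?I"
      using insert.prems insert.hyps j(1) by simp_all
    obtain c where c: "\<exists>i\<in>?I. c i \<noteq> 0"
      and sum: "\<forall>l\<in>K. (\<Sum>i\<in>?I. c i * (v j k * v i l - v i k * v j l)) = 0"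
      using insert.IH[OF fin card, of "\<lambda>i l. v j k * v i l - v i k * v j l"] by blast
    \<comment> \<open>Back substitution: expanding the relation among the cross-multiplied vectors
      gives these coefficients for the original ones. The nonzero pivot preserves
      nontriviality.\<close>
    define d where "d i = (if i = j then - (\<Sum>i\<in>?I. c i * v i k) else c i * v j k)" for i
    have "\<exists>i\<in>I. d i \<noteq> 0"
      using c j(2) by (auto simp: d_def)
    moreover have "(\<Sum>i\<in>I. d i * v i l) = 0" if "l \<in> insert k K" for l
    proof -
      have "(\<Sum>i\<in>I. d i * v i l) = d j * v j l + (\<Sum>i\<in>?I. d i * v i l)"
        using insert.prems(1) j(1) by (rule sum.remove)
      also have "(\<Sum>i\<in>?I. d i * v i l) = (\<Sum>i\<in>?I. c i * v j k * v i l)"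
        by (intro sum.cong) (auto simp: d_def)
      also have "d j * v j l + \<dots> = (\<Sum>i\<in>?I. c i * (v j k * v i l - v i k * v j l))"
        by (simp add: d_def sum_distrib_left sum_distrib_right right_diff_distrib sum_subtractf mult_ac)
      also have "\<dots> = 0"
        using that sum by (auto simp: mult.commute)
      finally show ?thesis .
    qed
    ultimately show ?thesis
      by blast
  qed
qed

text \<open>Descent on the total degree: while \<open>f\<close> divides every coefficient, dividing
  by it keeps a nontrivial relation of smaller degree.\<close>

lemma not_all_divisible_dependence:
  fixes P :: "'i \<Rightarrow> 'k \<Rightarrow> 'a::field poly"
  assumes "finite I" and f: "0 < degree f"
    and "\<exists>i\<in>I. p i \<noteq> 0" and "\<forall>k\<in>K. (\<Sum>i\<in>I. p i * P i k) = 0"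
  shows "\<exists>p. (\<exists>i\<in>I. \<not> f dvd p i) \<and> (\<forall>k\<in>K. (\<Sum>i\<in>I. p i * P i k) = 0)"
  using assms(3,4)
proof (induction "\<Sum>i\<in>I. degree (p i)" arbitrary: p rule: less_induct)
  case less
  show ?case
  proof (cases "\<exists>i\<in>I. \<not> f dvd p i")
    case True
    then show ?thesis
      using less.prems(2) by (intro exI[of _ p] conjI)
  next
    case False
    define r where "r i = p i div f" for i
    have p: "p i = f * r i" if "i \<in> I" for i
      using False that by (simp add: r_def)
    have f0: "f \<noteq> 0"
      using f by auto
    obtain j where j: "j \<in> I" "p j \<noteq> 0"
      using less.prems(1) by blast
    have nz: "r j \<noteq> 0"
      using j p by auto
    have deg: "degree (p i) = degree f + degree (r i)" if "i \<in> I" "r i \<noteq> 0" for i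
      using that f0 by (simp add: p degree_mult_eq)
    have "degree (r i) \<le> degree (p i)" if "i \<in> I" for i
      using deg[OF that] by (cases "r i = 0") auto
    moreover have "degree (r j) < degree (p j)"
      using deg[OF j(1) nz] f by simp
    ultimately have smaller: "(\<Sum>i\<in>I. degree (r i)) < (\<Sum>i\<in>I. degree (p i))"
      using j(1) by (intro sum_strict_mono_ex1[OF assms(1)] ballI bexI[of _ j])
    have "(\<Sum>i\<in>I. r i * P i k) = 0" if "k \<in> K" for k
    proof -
      have "(\<Sum>i\<in>I. p i * P i k) = f * (\<Sum>i\<in>I. r i * P i k)"
        by (simp add: sum_distrib_left p mult.assoc)
      then have "f * (\<Sum>i\<in>I. r i * P i k) = 0"
        using less.prems(2) that by simp
      then show ?thesis
        using f0 by simp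
    qed
    moreover have "\<exists>i\<in>I. r i \<noteq> 0"
      using j(1) nz by (rule bexI[rotated])
    ultimately show ?thesis
      by (intro less.hyps[OF smaller] ballI)
  qed
qed

lemma exists_modulus:
  fixes P :: "'i \<Rightarrow> 'k \<Rightarrow> 'a::field poly"
  assumes n: "0 < n" and K: "finite K" and I: "finite I" and card: "card K < card I"
  obtains f p where "degree f = n" and "\<forall>k\<in>K. (\<Sum>i\<in>I. p i * P i k) = 0"
    and "\<exists>i\<in>I. \<not> f dvd p i"
    and "\<And>i h. i \<in> I \<Longrightarrow> \<not> f dvd p i \<Longrightarrow> f dvd p i * h \<Longrightarrow> f dvd h"
proof -
  obtain p where p: "\<exists>i\<in>I. p i \<noteq> 0" "\<forall>k\<in>K. (\<Sum>i\<in>I. p i * P i k) = 0"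
    using idom_linear_dependence[OF K I card, of P] by blast
  show ?thesis
  proof (cases "finite (UNIV :: 'a set)")
    case True
    obtain f :: "'a poly" where f: "degree f = n" "prime_elem f"
      using exists_prime_elem_poly_degree[OF True n] .
    have "0 < degree f"
      using f(1) n by simp
    from not_all_divisible_dependence[OF I this p]
    obtain r where r: "\<exists>i\<in>I. \<not> f dvd r i" "\<forall>k\<in>K. (\<Sum>i\<in>I. r i * P i k) = 0"
      by blast
    have "f dvd h" if "\<not> f dvd r i" "f dvd r i * h" for i h
      using prime_elem_dvd_multD[OF f(2) that(2)] that(1) by blast
    then show ?thesis
      by (rule that[OF f(1) r(2,1)])
  next
    case False
    have "finite (\<Union>i\<in>{i\<in>I. p i \<noteq> 0}. {x. poly (p i) x = 0})"
      using I by (auto intro: poly_roots_finite)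
    then obtain c where "c \<notin> (\<Union>i\<in>{i\<in>I. p i \<noteq> 0}. {x. poly (p i) x = 0})"
      using ex_new_if_finite[OF False] by blast
    then have c: "poly (p i) c \<noteq> 0" if "i \<in> I" "p i \<noteq> 0" for i
      using that by blast
    define f where "f = [:-c, 1:] ^ n"
    have ord: "order c (p i) = 0" if "i \<in> I" "p i \<noteq> 0" for i
      using c[OF that] by (rule order_0I)
    have not_dvd: "\<not> f dvd p i" if "i \<in> I" "p i \<noteq> 0" for i
      using ord[OF that] that n by (simp add: f_def order_divides)
    \<comment> \<open>Since \<open>p i\<close> has order 0 at \<open>c\<close>, the order of
      \<open>p i * h\<close> at \<open>c\<close> is that of \<open>h\<close>.\<close>
    have "f dvd h" if "i \<in> I" "\<not> f dvd p i" "f dvd p i * h" for i h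
    proof (cases "h = 0")
      case False
      have "p i \<noteq> 0"
        using that(2) by auto
      then show ?thesis
        using that(1,3) False ord[of i] by (simp add: f_def order_divides order_mult)
    qed simp
    moreover have "degree f = n"
      by (simp add: f_def degree_power_eq)
    moreover have "\<exists>i\<in>I. \<not> f dvd p i"
      using p(1) not_dvd by blast
    ultimately show ?thesis
      by (intro that[OF _ p(2)])
  qed
qed

section \<open>Multiplication modulo a polynomial\<close>

definition poly_of_coeffs :: "nat \<Rightarrow> (nat \<Rightarrow> 'a::comm_semiring_0) \<Rightarrow> 'a poly" where
  "poly_of_coeffs n a = (\<Sum>j<n. monom (a j) j)"

lemma coeff_poly_of_coeffs: "coeff (poly_of_coeffs n a) j = (if j < n then a j else 0)"
  by (simp add: poly_of_coeffs_def coeff_sum)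

lemma degree_poly_of_coeffs: "0 < n \<Longrightarrow> degree (poly_of_coeffs n a) < n"
  by (intro le_less_trans[OF degree_le[where n = "n - 1"]]) (auto simp: coeff_poly_of_coeffs)

text \<open>For \<open>degree f = n\<close> this is multiplication by \<open>p\<close> on K[X]/(f)
  in the basis 1, X, ..., X^(n-1).\<close>

definition mult_mod_mat :: "nat \<Rightarrow> 'a::field poly \<Rightarrow> 'a poly \<Rightarrow> 'a mat" where
  "mult_mod_mat n f p = mat n n (\<lambda>(r, j). coeff ((p * monom 1 j) mod f) r)"

lemma mult_mod_mat_carrier [simp]: "mult_mod_mat n f p \<in> carrier_mat n n"
  by (simp add: mult_mod_mat_def)

lemma mod_poly_sum: "(\<Sum>j\<in>A. p j) mod f = (\<Sum>j\<in>A. p j mod f)" for f :: "'a::field poly"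
  by (induction A rule: infinite_finite_induct) (simp_all add: poly_mod_add_left)

text \<open>Linearity of the remainder extends the action from the monomials, stored as columns, to
  every coefficient vector.\<close>

lemma mult_mod_mat_coeffs:
  assumes "r < n"
  shows "(\<Sum>j<n. mult_mod_mat n f p $$ (r, j) * a j) = coeff ((p * poly_of_coeffs n a) mod f) r"
proof -
  have "p * monom (a j) j = smult (a j) (p * monom 1 j)" for j
    by (metis mult.right_neutral mult_smult_right smult_monom)
  then have "p * poly_of_coeffs n a = (\<Sum>j<n. smult (a j) (p * monom 1 j))"
    by (simp only: poly_of_coeffs_def sum_distrib_left)
  then show ?thesis
    using assms
    by (simp add: mult_mod_mat_def mod_poly_sum mod_smult_left coeff_sum mult.commute)
qed

lemma mult_mod_mat_eq_0:
  assumes "f dvd p"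
  shows "mult_mod_mat n f p = 0\<^sub>m n n"
  using assms by (intro eq_matI) (auto simp: mult_mod_mat_def)

text \<open>A kernel vector is a polynomial of degree below \<open>n\<close> that \<open>reg\<close>
  makes divisible by \<open>f\<close>, hence zero; an injective square matrix over a field is
  invertible.\<close>

lemma mult_mod_mat_GL:
  assumes f: "degree f = n" and n: "0 < n" and reg: "\<And>h. f dvd p * h \<Longrightarrow> f dvd h"
  shows "mult_mod_mat n f p \<in> GL n"
proof -
  let ?G = "mult_mod_mat n f p"
  have f0: "f \<noteq> 0"
    using f n by auto
  have "v = 0\<^sub>v n" if v: "v \<in> carrier_vec n" and ker: "?G *\<^sub>v v = 0\<^sub>v n" for v
  proof -
    let ?h = "poly_of_coeffs n (\<lambda>j. v $ j)"
    have low: "coeff ((p * ?h) mod f) r = 0" if "r < n" for r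
    proof -
      have "coeff ((p * ?h) mod f) r = (\<Sum>j<n. ?G $$ (r, j) * v $ j)"
        using that by (simp add: mult_mod_mat_coeffs)
      also have "\<dots> = (?G *\<^sub>v v) $ r"
        using that carrier_vecD[OF v] carrier_matD[OF mult_mod_mat_carrier[of n f p]]
        by (simp add: scalar_prod_def lessThan_atLeast0)
      finally show ?thesis
        using that by (simp only: ker index_zero_vec)
    qed
    have "(p * ?h) mod f = 0"
    proof (rule ccontr)
      assume nz: "(p * ?h) mod f \<noteq> 0"
      then have "degree ((p * ?h) mod f) < n"
        using degree_mod_less[OF f0, of "p * ?h"] f by blast
      then have "lead_coeff ((p * ?h) mod f) = 0"
        by (rule low)
      with nz show False
        by (simp only: leading_coeff_0_iff)
    qed
    then have "f dvd ?h"
      by (rule reg[OF mod_0_imp_dvd])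
    then have "?h = 0"
      using dvd_imp_degree_le[of f ?h] degree_poly_of_coeffs[OF n, of "\<lambda>j. v $ j"] f
      by (metis leD)
    then have "v $ j = 0" if "j < n" for j
      using coeff_poly_of_coeffs[of n "\<lambda>j. v $ j" j] that by (metis coeff_0)
    then show ?thesis
      using carrier_vecD[OF v] by (intro eq_vecI) simp_all
  qed
  then have "det ?G \<noteq> 0"
    unfolding det_0_iff_vec_prod_zero_field[OF mult_mod_mat_carrier] by blast
  then have "?G \<in> Units (ring_mat TYPE('a) n ())"
    by (rule det_non_zero_imp_unit[OF mult_mod_mat_carrier])
  then have "\<exists>B\<in>carrier_mat n n. B * ?G = 1\<^sub>m n \<and> ?G * B = 1\<^sub>m n"
    by (simp add: Units_def ring_mat_def)
  then obtain B where B: "B \<in> carrier_mat n n" "B * ?G = 1\<^sub>m n" "?G * B = 1\<^sub>m n"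
    by blast
  moreover have "dim_row ?G = n" "dim_col ?G = n" "dim_row B = n"
    using carrier_matD[OF mult_mod_mat_carrier[of n f p]] B(1) by simp_all
  ultimately have "inverts_mat ?G B" "inverts_mat B ?G" "square_mat ?G"
    by (simp_all add: inverts_mat_def)
  then show ?thesis
    unfolding GL_def invertible_mat_def using mult_mod_mat_carrier by blast
qed

text \<open>Reduces the \<open>finsum\<close> of matrices to ordinary sums of entries. Carrier
  membership joins the induction because indexing a sum requires the dimensions of the partial
  sum.\<close>

lemma finsum_module_mat_index:
  fixes A :: "'i \<Rightarrow> 'a::comm_ring_1 mat"
  assumes "finite F" and "\<And>i. i \<in> F \<Longrightarrow> A i \<in> carrier_mat nr nc"
  shows "finsum (module_mat TYPE('a) nr nc) A F \<in> carrier_mat nr nc \<and>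
    (\<forall>r<nr. \<forall>k<nc. finsum (module_mat TYPE('a) nr nc) A F $$ (r, k) = (\<Sum>i\<in>F. A i $$ (r, k)))"
  using assms
proof (induction F rule: finite_induct)
  interpret abelian_group "module_mat TYPE('a) nr nc"
    by (rule abelian_group_mat)
  case empty
  then show ?case
    by (simp add: module_mat_simps)
next
  interpret abelian_group "module_mat TYPE('a) nr nc"
    by (rule abelian_group_mat)
  case (insert i F)
  have "A \<in> F \<rightarrow> carrier (module_mat TYPE('a) nr nc)"
    and "A i \<in> carrier (module_mat TYPE('a) nr nc)"
    using insert.prems by (auto simp: module_mat_simps)
  note eq = finsum_insert[OF insert.hyps this, unfolded module_mat_simps]
  show ?case
    unfolding eq using insert by auto
qed

section \<open>From the polynomial relation to the matrix relation\<close>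

theorem theorem1:
  fixes n m :: nat and M :: "nat \<Rightarrow> 'a :: field mat"
  assumes "n > 0" and "m > 0"
    and "\<And>i. i \<in> {1..m + 1} \<Longrightarrow> M i \<in> carrier_mat n m"
  shows "GL_dependent n m (m + 1) M"
proof -
  let ?I = "{1..m + 1}"
  define P where "P i k = poly_of_coeffs n (\<lambda>j. M i $$ (j, k))" for i k
  \<comment> \<open>The \<open>m\<close> columns give \<open>m\<close> equations in
    \<open>m + 1\<close> unknown polynomials.\<close>
  obtain f p where f: "degree f = n"
    and sum: "\<forall>k\<in>{..<m}. (\<Sum>i\<in>?I. p i * P i k) = 0"
    and nz: "\<exists>i\<in>?I. \<not> f dvd p i"
    and reg: "\<And>i h. i \<in> ?I \<Longrightarrow> \<not> f dvd p i \<Longrightarrow> f dvd p i * h \<Longrightarrow> f dvd h"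
    by (rule exists_modulus[of n "{..<m}" ?I P]) (use assms(1) in auto)
  define g where "g i = mult_mod_mat n f (p i)" for i
  have g_carrier: "g i \<in> carrier_mat n n" for i
    by (simp add: g_def)
  have g_GL: "g i \<in> GL n" if "i \<in> ?I" "\<not> f dvd p i" for i
    unfolding g_def using reg[OF that] by (intro mult_mod_mat_GL f assms(1))
  \<comment> \<open>Membership in \<open>GL n\<close> must yield a nonzero \<open>g i\<close>; with
    \<open>n > 0\<close> the entry at \<open>(0, 0)\<close> separates zero from the
    identity.\<close>
  have "0\<^sub>m n n \<notin> (GL n :: 'a mat set)"
  proof
    assume "0\<^sub>m n n \<in> (GL n :: 'a mat set)"
    then obtain B :: "'a mat" where B: "0\<^sub>m n n * B = 1\<^sub>m n" "B * 0\<^sub>m n n = 1\<^sub>m (dim_row B)"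
      by (auto simp: GL_def invertible_mat_def inverts_mat_def)
    have "dim_col B = n"
      using arg_cong[OF B(1), of dim_col] by simp
    moreover have "dim_row B = n"
      using arg_cong[OF B(2), of dim_col] by simp
    ultimately have "0\<^sub>m n n * B = 0\<^sub>m n n"
      by (intro left_mult_zero_mat) auto
    then have "(1\<^sub>m n :: 'a mat) $$ (0, 0) = 0\<^sub>m n n $$ (0, 0)"
      using B(1) by simp
    then show False
      using assms(1) by simp
  qed
  then have "\<exists>i\<in>?I. g i \<noteq> 0\<^sub>m n n"
    using nz g_GL by force
  moreover have "\<forall>i\<in>?I. g i \<in> GL n \<union> {0\<^sub>m n n}"
  proof
    fix i
    assume "i \<in> ?I"
    then show "g i \<in> GL n \<union> {0\<^sub>m n n}"
      using g_GL[of i] mult_mod_mat_eq_0[of f "p i" n] by (cases "f dvd p i") (auto simp: g_def)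
  qed
  moreover have "finsum (module_mat TYPE('a) n m) (\<lambda>i. g i * M i) ?I = 0\<^sub>m n m"
  proof -
    have gM: "g i * M i \<in> carrier_mat n m" if "i \<in> ?I" for i
      using g_carrier assms(3)[OF that] by (rule mult_carrier_mat)
    note fs = finsum_module_mat_index[of ?I "\<lambda>i. g i * M i", OF _ gM]
    have "(\<Sum>i\<in>?I. (g i * M i) $$ (r, k)) = 0" if rk: "r < n" "k < m" for r k
    proof -
      \<comment> \<open>Column \<open>k\<close> of \<open>g i * M i\<close> represents
        \<open>p i * P i k\<close> modulo \<open>f\<close>, so summing over \<open>i\<close> gives
        the remainder of the zero polynomial.\<close>
      have "(g i * M i) $$ (r, k) = coeff ((p i * P i k) mod f) r" if i: "i \<in> ?I" for i
      proof -
        have "(g i * M i) $$ (r, k) = (\<Sum>j<n. g i $$ (r, j) * M i $$ (j, k))"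
          using rk carrier_matD[OF g_carrier[of i]] carrier_matD[OF assms(3)[OF i]]
          by (simp add: scalar_prod_def lessThan_atLeast0)
        then show ?thesis
          unfolding g_def P_def by (simp add: mult_mod_mat_coeffs[OF rk(1)])
      qed
      then have "(\<Sum>i\<in>?I. (g i * M i) $$ (r, k)) = coeff ((\<Sum>i\<in>?I. p i * P i k) mod f) r"
        by (simp add: mod_poly_sum coeff_sum del: sum.cl_ivl_Suc)
      then show ?thesis
        using sum rk(2) by simp
    qed
    then show ?thesis
      using fs by (intro eq_matI) auto
  qed
  ultimately show ?thesis
    unfolding GL_dependent_def by blast
qed

end
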